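(* Let $(j_n)_{n\ge 0}$ be defined by $j_0=0$ and $j_n=\left(\frac{-1}{n}\right)$ (the Jacobi–Kronecker symbol) for $n\ge 1$; equivalently $j_0=0$, $j_{2k}=j_k$ and $j_{2k+1}=(-1)^k$ for all $k\ge 0$. Let $s_n=1+\sum_{0\le k\le n} j_k$ for $n\ge 0$. Then for every integer $m$ and every $n\ge 0$, $s_n=m$ if and only if the base-$2$ representation of $n$ has exactly $m-1$ runs (the representation of $0$ is taken to be empty, with $0$ runs). Furthermore, for every $N\ge 0$, the set of values $\{s_0,s_1,\ldots,s_{2^N-1}\}$ is $\{1,2,\ldots,N+1\}$.
   Context: A run in a word is a maximal block of consecutive identical letters. The base-$2$ representation of a positive integer is its standard binary expansion without leading zeros. *)

theory Defs
  imports "HOL-Number_Theory.Number_Theory"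
begin

definition kronecker_prime :: "int \<Rightarrow> int \<Rightarrow> int" where
  "kronecker_prime a p =
     (if p = 2 then (if even a then 0 else if a mod 8 = 1 \<or> a mod 8 = 7 then 1 else - 1)
      else Legendre a p)"

text \<open>
  The Kronecker symbol for arbitrary integers: a denominator \<open>n \<noteq> 0\<close> is factored as a unit times
  prime powers, the symbol over \<open>- 1\<close> being the sign of the numerator (with \<open>0\<close> counted as
  non-negative). For odd positive \<open>n\<close> this is the Jacobi symbol.
\<close>

definition kronecker :: "int \<Rightarrow> int \<Rightarrow> int" where
  "kronecker a n =
     (if n = 0 then (if \<bar>a\<bar> = 1 then 1 else 0)
      else (if n < 0 \<and> a < 0 then - 1 else 1) *
           (\<Prod>p\<in>prime_factors n. kronecker_prime a p ^ multiplicity p n))"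

text \<open>
  The value at \<open>0\<close> is a separate convention: the Kronecker symbol of \<open>- 1\<close> over \<open>0\<close> is \<open>1\<close>.
\<close>

definition jseq :: "nat \<Rightarrow> int" where
  "jseq n = (if n = 0 then 0 else kronecker (- 1) (int n))"

definition sseq :: "nat \<Rightarrow> int" where
  "sseq n = 1 + (\<Sum>k = 0..n. jseq k)"

text \<open>Most significant digit first; the expansion of \<open>0\<close> is the empty word.\<close>

fun base2 :: "nat \<Rightarrow> nat list" where
  "base2 n = (if n = 0 then [] else base2 (n div 2) @ [n mod 2])"

declare base2.simps [simp del]

text \<open>A block of \<open>w\<close> is given by its half-open range of positions \<open>{i..<j}\<close> and is non-empty.\<close>

definition const_block :: "'a list \<Rightarrow> nat \<Rightarrow> nat \<Rightarrow> bool" where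
  "const_block w i j \<longleftrightarrow>
     i < j \<and> j \<le> length w \<and> (\<forall>k\<in>{i..<j}. \<forall>l\<in>{i..<j}. w ! k = w ! l)"

definition is_run :: "'a list \<Rightarrow> nat \<Rightarrow> nat \<Rightarrow> bool" where
  "is_run w i j \<longleftrightarrow> const_block w i j \<and>
     (\<forall>i' j'. const_block w i' j' \<and> {i..<j} \<subseteq> {i'..<j'} \<longrightarrow> i' = i \<and> j' = j)"

definition num_runs :: "'a list \<Rightarrow> nat" where
  "num_runs w = card {(i, j). is_run w i j}"

end

theory Submission
  imports Defs
begin

text \<open>
  The symbol is completely multiplicative in its denominator and congruent modulo 4 to an odd
  denominator, whence the recursion for \<open>jseq\<close>. Summing that recursion, the partial sums grow by
  one from \<open>n div 2\<close> to \<open>n\<close> exactly when the last two binary digits of \<open>n\<close> differ, that is, when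
  appending the last digit to the expansion of \<open>n div 2\<close> opens a new run.
\<close>

section \<open>The Kronecker symbol of -1\<close>

text \<open>Products over multisets split along unions, so multiplicativity in the denominator
  becomes immediate. Positivity of \<open>n\<close> removes the sign factor.\<close>

lemma kronecker_eq_prod_mset:
  assumes "n > 0"
  shows "kronecker a n = (\<Prod>p\<in>#prime_factorization n. kronecker_prime a p)"
proof -
  have "kronecker a n = (\<Prod>p\<in>prime_factors n. kronecker_prime a p ^ multiplicity p n)"
    using assms by (simp add: kronecker_def)
  also have "\<dots> = (\<Prod>p\<in>prime_factors n. kronecker_prime a p ^ count (prime_factorization n) p)"
    by (intro prod.cong) (auto simp: count_prime_factorization_prime in_prime_factors_iff)
  finally show ?thesis
    by (simp add: image_prod_mset_multiplicity)
qed

lemma kronecker_mult_right: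
  assumes "m > 0" "n > 0"
  shows "kronecker a (m * n) = kronecker a m * kronecker a n"
  using assms by (simp add: kronecker_eq_prod_mset prime_factorization_mult)

lemma kronecker_neg_one_two: "kronecker (- 1) 2 = 1"
proof -
  have "prime_factorization (2 :: int) = {#2#}"
    by (rule prime_factorization_prime) simp
  thus ?thesis
    by (simp add: kronecker_eq_prod_mset kronecker_prime_def)
qed

text \<open>Euler's criterion gives \<open>(- 1) ^ k\<close> modulo \<open>p = 2 * k + 1\<close>,
  and two signs congruent modulo \<open>p > 2\<close> are equal.\<close>

lemma kronecker_prime_neg_one_cong:
  assumes "prime p" "odd (p :: int)"
  shows "kronecker_prime (- 1) p \<in> {- 1, 1}" "[kronecker_prime (- 1) p = p] (mod 4)"
proof -
  have "p > 2"
    using assms prime_ge_2_int[of p] by (cases "p = 2") auto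
  have 1: "kronecker_prime (- 1) p = Legendre (- 1) p"
    using \<open>p > 2\<close> by (simp add: kronecker_prime_def)
  obtain k where k: "nat p = 2 * k + 1"
    using assms(2) \<open>p > 2\<close> by (metis even_nat_iff oddE less_imp_le order_less_trans zero_less_numeral)
  have pk: "p = 2 * int k + 1"
    using k \<open>p > 2\<close> by linarith
  have p_arith: "int (nat p) = p" "(nat p - 1) div 2 = k"
    using k \<open>p > 2\<close> by simp_all
  have "[Legendre (- 1) (int (nat p)) = (- 1) ^ ((nat p - 1) div 2)] (mod int (nat p))"
    using assms \<open>p > 2\<close> by (intro euler_criterion) auto
  hence c: "[Legendre (- 1) p = (- 1) ^ k] (mod p)"
    unfolding p_arith .
  \<comment> \<open>This excludes the value 0 of the Legendre symbol.\<close>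
  have "\<not> [- 1 = 0] (mod p)"
    using \<open>p > 2\<close> by (auto simp: cong_0_iff zdvd_not_zless)
  hence L: "Legendre (- 1) p \<in> {- 1, 1}"
    by (simp add: Legendre_def)
  have E: "(- 1 :: int) ^ k \<in> {- 1, 1}"
    by (cases "even k") auto
  have "Legendre (- 1) p = (- 1) ^ k"
  proof (rule ccontr)
    assume "Legendre (- 1) p \<noteq> (- 1) ^ k"
    hence "Legendre (- 1) p - (- 1) ^ k \<in> {- 2, 2}"
      using L E by auto
    moreover have "p dvd Legendre (- 1) p - (- 1) ^ k"
      using c by (simp add: cong_iff_dvd_diff)
    ultimately have "p dvd 2" by auto
    thus False using \<open>p > 2\<close> zdvd_imp_le by force
  qed
  moreover have "[(- 1) ^ k = p] (mod 4)"
    unfolding pk by (cases "even k") (auto elim!: evenE oddE simp: cong_iff_dvd_diff)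
  ultimately show "kronecker_prime (- 1) p \<in> {- 1, 1}" "[kronecker_prime (- 1) p = p] (mod 4)"
    using 1 L by auto
qed

text \<open>Being a sign and being congruent to the denominator modulo 4 both pass from odd primes
  to products; a sign is determined by its residue modulo 4.\<close>

lemma kronecker_neg_one_odd:
  "kronecker (- 1) (2 * int k + 1) = (- 1) ^ k"
proof -
  define n where "n = 2 * int k + 1"
  \<comment> \<open>Stated for any multiset of odd primes, so that induction can remove one prime at
    a time.\<close>
  have "\<forall>p. p \<in># M \<longrightarrow> prime p \<and> odd p \<Longrightarrow>
      (\<Prod>p\<in>#M. kronecker_prime (- 1) p) \<in> {- 1, 1} \<and>
      [(\<Prod>p\<in>#M. kronecker_prime (- 1) p) = prod_mset M] (mod 4)" for M :: "int multiset"
  proof (induction M)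
    case (add p M)
    hence IH: "(\<Prod>p\<in>#M. kronecker_prime (- 1) p) \<in> {- 1, 1}"
        "[(\<Prod>p\<in>#M. kronecker_prime (- 1) p) = prod_mset M] (mod 4)"
      by auto
    have p: "kronecker_prime (- 1) p \<in> {- 1, 1}" "[kronecker_prime (- 1) p = p] (mod 4)"
      using add.prems kronecker_prime_neg_one_cong[of p] by auto
    show ?case
      using p(1) IH(1) cong_mult[OF p(2) IH(2)] by auto
  qed auto
  moreover have "prime p \<and> odd p" if "p \<in># prime_factorization n" for p
  proof
    show "prime p"
      using that by (simp add: in_prime_factors_iff)
    have "p dvd n" "odd n"
      using that by (auto simp: in_prime_factors_iff n_def)
    thus "odd p"
      by (meson dvd_trans)
  qed
  moreover have "n > 0" by (simp add: n_def)
  ultimately have K: "kronecker (- 1) n \<in> {- 1, 1}" "[kronecker (- 1) n = n] (mod 4)"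
    using prod_mset_prime_factorization_int[of n] kronecker_eq_prod_mset[of n "- 1"]
    by (metis (no_types, lifting))+
  have "[n = (- 1) ^ k] (mod 4)"
    unfolding n_def by (cases "even k") (auto elim!: evenE oddE simp: cong_iff_dvd_diff)
  with K(2) have "[kronecker (- 1) n = (- 1) ^ k] (mod 4)"
    by (rule cong_trans)
  with K(1) show ?thesis
    unfolding n_def by (cases "even k") (auto simp: cong_def)
qed

section \<open>The recursion for \<open>jseq\<close>\<close>

lemma jseq_0: "jseq 0 = 0"
  by (simp add: jseq_def)

lemma jseq_double: "jseq (2 * k) = jseq k"
proof (cases "k = 0")
  case False
  thus ?thesis
    using kronecker_mult_right[of 2 "int k" "- 1"] by (simp add: jseq_def kronecker_neg_one_two)
qed simp

lemma jseq_double_plus_one: "jseq (2 * k + 1) = (- 1) ^ k"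
  using kronecker_neg_one_odd[of k] by (simp add: jseq_def add.commute)

lemma eq_jseq_iff:
  "f = jseq \<longleftrightarrow> f 0 = 0 \<and> (\<forall>k. f (2 * k) = f k) \<and> (\<forall>k. f (2 * k + 1) = (- 1) ^ k)"
proof
  assume f: "f 0 = 0 \<and> (\<forall>k. f (2 * k) = f k) \<and> (\<forall>k. f (2 * k + 1) = (- 1) ^ k)"
  have "f n = jseq n" for n
  proof (induction n rule: less_induct)
    case (less n)
    show ?case
    proof (cases "even n")
      case True
      then obtain k where "n = 2 * k" by (elim evenE)
      thus ?thesis
        using f less[of k] jseq_0 jseq_double[of k] by (cases "k = 0") auto
    next
      case False
      then obtain k where "n = 2 * k + 1" by (elim oddE)
      thus ?thesis using f jseq_double_plus_one by metis
    qed
  qed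
  thus "f = jseq" by blast
next
  assume "f = jseq"
  thus "f 0 = 0 \<and> (\<forall>k. f (2 * k) = f k) \<and> (\<forall>k. f (2 * k + 1) = (- 1) ^ k)"
    using jseq_0 jseq_double jseq_double_plus_one by blast
qed

section \<open>The recursion for the partial sums\<close>

lemma sseq_0: "sseq 0 = 1"
  by (simp add: sseq_def jseq_0)

lemma sseq_Suc: "sseq (Suc n) = sseq n + jseq (Suc n)"
  by (simp add: sseq_def)

text \<open>The terms at \<open>2 * i\<close> and \<open>2 * i + 1\<close> add up to
  \<open>jseq i + (- 1) ^ i\<close>, and the alternating sum of signs over \<open>i \<le> k\<close>
  is 1 or 0 according to the parity of \<open>k\<close>.\<close>

lemma sseq_double_plus_one: "sseq (2 * k + 1) = sseq k + (if even k then 1 else 0)"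
proof (induction k)
  case 0
  thus ?case using jseq_double_plus_one[of 0] by (simp add: sseq_Suc sseq_0)
next
  case (Suc k)
  have "sseq (2 * Suc k + 1) = sseq (2 * k + 1) + jseq (2 * Suc k) + jseq (2 * Suc k + 1)"
    by (simp add: sseq_Suc)
  thus ?case
    using Suc unfolding jseq_double jseq_double_plus_one by (simp add: sseq_Suc)
qed

lemma sseq_double: "sseq (2 * k) = sseq k + (if even k then 0 else 1)"
  using sseq_double_plus_one[of k] jseq_double_plus_one[of k] sseq_Suc[of "2 * k"] by auto

lemma sseq_rec: "sseq n = sseq (n div 2) + (if even n = even (n div 2) then 0 else 1)"
proof (cases "even n")
  case True
  then obtain k where "n = 2 * k" by (elim evenE)
  thus ?thesis using sseq_double[of k] by simp
next
  case False
  then obtain k where "n = 2 * k + 1" by (elim oddE)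
  thus ?thesis using sseq_double_plus_one[of k] by simp
qed

section \<open>Counting runs by their left ends\<close>

definition run_starts :: "'a list \<Rightarrow> nat set" where
  "run_starts w = {i. i < length w \<and> (i = 0 \<or> w ! (i - 1) \<noteq> w ! i)}"

lemma const_block_iff: "const_block w i j \<longleftrightarrow> i < j \<and> j \<le> length w \<and> (\<forall>k\<in>{i..<j}. w ! k = w ! i)"
proof (cases "i < j")
  case True
  hence "i \<in> {i..<j}" by simp
  hence "(\<forall>k\<in>{i..<j}. \<forall>l\<in>{i..<j}. w ! k = w ! l) \<longleftrightarrow> (\<forall>k\<in>{i..<j}. w ! k = w ! i)"
    by metis
  thus ?thesis by (simp only: const_block_def)
qed (simp add: const_block_def)

text \<open>If the preceding letter were equal, the block could be extended to the left.\<close>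

lemma is_run_imp_run_start:
  assumes "is_run w i j"
  shows "i \<in> run_starts w"
proof -
  have b: "i < j" "j \<le> length w" "\<forall>k\<in>{i..<j}. w ! k = w ! i"
    using assms unfolding is_run_def const_block_iff by blast+
  have "w ! (i - 1) \<noteq> w ! i" if "i > 0"
  proof
    assume eq: "w ! (i - 1) = w ! i"
    have "w ! k = w ! (i - 1)" if "k \<in> {i - 1..<j}" for k
    proof (cases "k = i - 1")
      case False
      hence "k \<in> {i..<j}" using that by auto
      thus ?thesis using b(3) eq by metis
    qed simp
    moreover have "i - 1 < j" using b(1) by simp
    ultimately have "const_block w (i - 1) j"
      using b(2) unfolding const_block_iff by blast
    moreover have "{i..<j} \<subseteq> {i - 1..<j}" by auto
    \<comment> \<open>With truncated subtraction this is absurd only because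
      \<open>i > 0\<close>.\<close>
    ultimately have "i - 1 = i"
      using assms unfolding is_run_def by blast
    thus False using that by simp
  qed
  thus ?thesis using b(1,2) by (auto simp: run_starts_def)
qed

text \<open>Blocks with a common left end are nested, so maximality identifies them.\<close>

lemma is_run_unique:
  assumes "is_run w i j" "is_run w i j'"
  shows "j = j'"
proof -
  have "{i..<j} \<subseteq> {i..<j'} \<or> {i..<j'} \<subseteq> {i..<j}" by auto
  thus ?thesis using assms unfolding is_run_def by blast
qed

text \<open>The longest constant block from \<open>i\<close> is a run: the differing letter before
  \<open>i\<close> prevents any extension to the left.\<close>

lemma run_start_imp_is_run:
  assumes "i \<in> run_starts w"
  shows "\<exists>j. is_run w i j"
proof -
  have i: "i < length w" "i = 0 \<or> w ! (i - 1) \<noteq> w ! i"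
    using assms by (auto simp: run_starts_def)
  define j where "j = (GREATEST j. const_block w i j)"
  have bound: "\<And>j. const_block w i j \<Longrightarrow> j \<le> length w"
    by (simp add: const_block_def)
  have "const_block w i (Suc i)"
    using i by (auto simp: const_block_iff)
  hence j: "const_block w i j"
    unfolding j_def by (rule GreatestI_nat[OF _ bound])
  have max: "j' \<le> j" if "const_block w i j'" for j'
    unfolding j_def using that bound by (rule Greatest_le_nat)
  have "i' = i \<and> j' = j" if b: "const_block w i' j'" and sub: "{i..<j} \<subseteq> {i'..<j'}" for i' j'
  proof -
    have ij: "i < j" using j by (simp add: const_block_def)
    hence le: "i' \<le> i" "j \<le> j'" using sub by (auto simp: ivl_subset)
    have eq: "w ! k = w ! l" if "k \<in> {i'..<j'}" "l \<in> {i'..<j'}" for k l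
      using b that unfolding const_block_def by blast
    have "i' = i"
    proof (rule ccontr)
      assume "i' \<noteq> i"
      hence "w ! (i - 1) = w ! i" "i \<noteq> 0" using le ij by (auto intro!: eq)
      thus False using i by simp
    qed
    moreover from this have "j' = j" using max[of j'] b le by simp
    ultimately show ?thesis ..
  qed
  hence "is_run w i j" using j by (auto simp: is_run_def)
  thus ?thesis ..
qed

lemma num_runs_eq_card_run_starts: "num_runs w = card (run_starts w)"
proof -
  have "bij_betw fst {(i, j). is_run w i j} (run_starts w)"
    unfolding bij_betw_def
  proof
    show "inj_on fst {(i, j). is_run w i j}"
      by (auto simp: inj_on_def dest: is_run_unique)
    show "fst ` {(i, j). is_run w i j} = run_starts w"
      using run_start_imp_is_run by (force dest: is_run_imp_run_start)
  qed
  thus ?thesis unfolding num_runs_def by (rule bij_betw_same_card)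
qed

lemma num_runs_Nil: "num_runs [] = 0"
  by (simp add: num_runs_eq_card_run_starts run_starts_def)

text \<open>Whether a position starts a run depends only on its letter and the one before, so
  appending affects only the new position \<open>length w\<close>.\<close>

lemma num_runs_snoc:
  "num_runs (w @ [a]) = num_runs w + (if w \<noteq> [] \<and> last w = a then 0 else 1)"
proof -
  have "run_starts (w @ [a]) =
      run_starts w \<union> (if w \<noteq> [] \<and> last w = a then {} else {length w})"
  proof (cases "w = []")
    case False
    hence "last w = w ! (length w - 1)" "0 < length w" by (simp_all add: last_conv_nth)
    thus ?thesis by (auto simp: run_starts_def nth_append less_Suc_eq)
  qed (auto simp: run_starts_def)
  moreover have "finite (run_starts w)" "length w \<notin> run_starts w"
    by (auto simp: run_starts_def)
  ultimately show ?thesis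
    unfolding num_runs_eq_card_run_starts by (cases "w \<noteq> [] \<and> last w = a") simp_all
qed

section \<open>Runs of binary expansions and the range of \<open>sseq\<close>\<close>

lemma sseq_eq_num_runs: "sseq n = int (num_runs (base2 n)) + 1"
proof (induction n rule: less_induct)
  case (less n)
  show ?case
  proof (cases "n = 0")
    case True
    thus ?thesis by (simp add: sseq_0 base2.simps[of 0] num_runs_Nil)
  next
    case False
    have last: "base2 k \<noteq> [] \<and> last (base2 k) = b \<longleftrightarrow> k \<noteq> 0 \<and> k mod 2 = b" for k b
      by (subst (1 2) base2.simps) auto
    have "num_runs (base2 n) = num_runs (base2 (n div 2)) +
        (if n div 2 \<noteq> 0 \<and> n div 2 mod 2 = n mod 2 then 0 else 1)"
      using False by (simp add: base2.simps[of n] num_runs_snoc last)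
    \<comment> \<open>At \<open>n = 1\<close> the word for \<open>n div 2\<close> is empty and the
      digit opens the first run; the parities of 0 and 1 differ as well, so both sides fail.\<close>
    moreover have "n div 2 \<noteq> 0 \<and> n div 2 mod 2 = n mod 2 \<longleftrightarrow> even n = even (n div 2)"
      using False by (cases "n = 1") (auto simp: even_iff_mod_2_eq_zero)
    ultimately show ?thesis
      using less[of "n div 2"] False sseq_rec[of n] by simp
  qed
qed

text \<open>One more binary digit raises the value by at most 1, and appending the digit opposite to
  the last one of a maximiser attains the new maximum.\<close>

lemma sseq_image: "sseq ` {..<2 ^ N} = {1..int N + 1}"
proof (induction N)
  case 0
  show ?case by (simp add: sseq_0 lessThan_Suc)
next
  case (Suc N)
  have step: "sseq n \<in> {1..int (Suc N) + 1}" if "n < 2 ^ Suc N" for n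
  proof -
    have "sseq (n div 2) \<in> {1..int N + 1}"
      unfolding Suc[symmetric] using that by auto
    thus ?thesis using sseq_rec[of n] by auto
  qed
  obtain k where k: "k < 2 ^ N" "sseq k = int N + 1"
    using Suc by (metis (no_types, lifting) atLeastAtMost_iff imageE lessThan_iff le_add_same_cancel2
      of_nat_0_le_iff order_refl)
  have top: "\<exists>n<2 ^ Suc N. sseq n = int N + 2"
  proof (cases "even k")
    case True
    thus ?thesis using k sseq_double_plus_one[of k] by (intro exI[of _ "2 * k + 1"]) auto
  next
    case False
    thus ?thesis using k sseq_double[of k] by (intro exI[of _ "2 * k"]) auto
  qed
  have "{1..int (Suc N) + 1} = insert (int N + 2) {1..int N + 1}" by auto
  also have "\<dots> \<subseteq> sseq ` {..<2 ^ Suc N}"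
    unfolding Suc[symmetric] using top by (auto intro!: image_eqI)
  finally show ?case using step by auto
qed

theorem theorem2:
  "(\<forall>f :: nat \<Rightarrow> int.
      f = jseq \<longleftrightarrow>
        f 0 = 0 \<and> (\<forall>k. f (2 * k) = f k) \<and> (\<forall>k. f (2 * k + 1) = (- 1) ^ k)) \<and>
   (\<forall>(m :: int) (n :: nat). sseq n = m \<longleftrightarrow> int (num_runs (base2 n)) = m - 1) \<and>
   (\<forall>N :: nat. sseq ` {0..2 ^ N - 1} = {1..int N + 1})"
proof (intro conjI allI)
  fix f :: "nat \<Rightarrow> int"
  show "f = jseq \<longleftrightarrow>
      f 0 = 0 \<and> (\<forall>k. f (2 * k) = f k) \<and> (\<forall>k. f (2 * k + 1) = (- 1) ^ k)"
    by (rule eq_jseq_iff)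
next
  fix m :: int and n :: nat
  show "sseq n = m \<longleftrightarrow> int (num_runs (base2 n)) = m - 1"
    by (auto simp: sseq_eq_num_runs)
next
  fix N :: nat
  \<comment> \<open>The subtraction on \<open>nat\<close> is not truncated, since
    \<open>2 ^ N\<close> is at least 1.\<close>
  have "{0..2 ^ N - 1} = {..<2 ^ N :: nat}"
    using less_eq_Suc_le by (auto simp: le_diff_conv2)
  thus "sseq ` {0..2 ^ N - 1} = {1..int N + 1}"
    by (simp add: sseq_image)
qed

end
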